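(* Suppose $\Omega$ is a nonempty, compact, totally disconnected metric space. For each $\epsilon>0$ the set $\mathcal C_\epsilon$ of $\epsilon$-components of $\Omega$ is a finite partition of $\Omega$ by clopen sets. If $0<\epsilon<\sigma$, then $\mathcal C_\epsilon$ is a refinement of $\mathcal C_\sigma$. The maximum diameter of a set in $\mathcal C_\epsilon$ has limit zero as $\epsilon\to0^+$.
   Context: For $\epsilon>0$, an $\epsilon$-chain from $y_1$ to $y_2$ in a metric space $(\Omega,d)$ is a finite sequence of points $x_1,\dots,x_K$ in $\Omega$ with $x_1=y_1$, $x_K=y_2$ and $d(x_k,x_{k+1})<\epsilon$ for all $k$. Being connected by an $\epsilon$-chain is an equivalence relation on $\Omega$; its equivalence classes are the $\epsilon$-components of $\Omega$, and $\mathcal C_\epsilon$ denotes the set of $\epsilon$-components. Clopen means both open and closed. A partition $\mathcal E_2$ of $\Omega$ is a refinement of a partition $\mathcal E_1$ if each set in $\mathcal E_2$ is a subset of a set in $\mathcal E_1$. *)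

theory Defs
  imports "HOL-Analysis.Analysis" "HOL-Library.Disjoint_Sets"
begin

text \<open>A metric space \<open>\<Omega>\<close> is rendered as a set in a type of class \<^class>\<open>metric_space\<close>, carrying
  the restricted metric and the subspace topology \<^term>\<open>top_of_set \<Omega>\<close>. All notions below
  depend only on the metric restricted to \<open>\<Omega>\<close>.\<close>

definition totally_disconnected :: "'a::topological_space set \<Rightarrow> bool" where
  "totally_disconnected \<Omega> \<longleftrightarrow> (\<forall>C \<in> components \<Omega>. \<exists>x. C = {x})"

definition eps_chain :: "'a::metric_space set \<Rightarrow> real \<Rightarrow> 'a \<Rightarrow> 'a \<Rightarrow> 'a list \<Rightarrow> bool" where
  "eps_chain \<Omega> \<epsilon> y\<^sub>1 y\<^sub>2 xs \<longleftrightarrow>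
     xs \<noteq> [] \<and> set xs \<subseteq> \<Omega> \<and> hd xs = y\<^sub>1 \<and> last xs = y\<^sub>2 \<and>
     (\<forall>k. Suc k < length xs \<longrightarrow> dist (xs ! k) (xs ! Suc k) < \<epsilon>)"

definition eps_rel :: "'a::metric_space set \<Rightarrow> real \<Rightarrow> ('a \<times> 'a) set" where
  "eps_rel \<Omega> \<epsilon> = {(y\<^sub>1, y\<^sub>2). \<exists>xs. eps_chain \<Omega> \<epsilon> y\<^sub>1 y\<^sub>2 xs}"

definition eps_components :: "'a::metric_space set \<Rightarrow> real \<Rightarrow> 'a set set" where
  "eps_components \<Omega> \<epsilon> = \<Omega> // eps_rel \<Omega> \<epsilon>"

definition clopen_in :: "'a::topological_space set \<Rightarrow> 'a set \<Rightarrow> bool" where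
  "clopen_in \<Omega> E \<longleftrightarrow> openin (top_of_set \<Omega>) E \<and> closedin (top_of_set \<Omega>) E"

end

theory Submission
  imports Defs
begin

text \<open>For \<open>\<epsilon> > 0\<close> every \<open>\<epsilon>\<close>-component contains the \<open>\<epsilon>\<close>-ball around each of its points, so the
  \<open>\<epsilon>\<close>-components form an open partition, which is finite by compactness. In a compact Hausdorff space
  components are quasicomponents, so total disconnectedness covers \<open>\<Omega>\<close> by finitely many clopen
  sets of small diameter. A clopen set has positive distance to its complement, hence for small
  \<open>\<epsilon>\<close> no \<open>\<epsilon>\<close>-chain leaves any of these sets, and each \<open>\<epsilon>\<close>-component lies inside one of them.\<close>

text \<open>Trades the indexed condition for \<open>successively\<close>, whose append and reversal
  rules let simplification handle chains as lists.\<close>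

lemma eps_chain_iff_successively:
  "eps_chain \<Omega> \<epsilon> x y xs \<longleftrightarrow>
     xs \<noteq> [] \<and> set xs \<subseteq> \<Omega> \<and> hd xs = x \<and> last xs = y \<and> successively (\<lambda>a b. dist a b < \<epsilon>) xs"
  by (auto simp: eps_chain_def successively_conv_nth)

text \<open>Joining across a jump from \<open>y\<close> to \<open>y'\<close> instead of at a shared
  point makes the new chain a plain append. Transitivity uses it with \<open>y' = y\<close>, where
  the jump has length 0.\<close>

lemma eps_chain_append:
  assumes "eps_chain \<Omega> \<epsilon> x y xs" "eps_chain \<Omega> \<epsilon> y' z ys" "dist y y' < \<epsilon>"
  shows "eps_chain \<Omega> \<epsilon> x z (xs @ ys)"
  using assms by (auto simp: eps_chain_iff_successively successively_append_iff)

lemma eps_chain_rev: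
  assumes "eps_chain \<Omega> \<epsilon> x y xs"
  shows "eps_chain \<Omega> \<epsilon> y x (rev xs)"
  using assms by (auto simp: eps_chain_iff_successively hd_rev last_rev dist_commute)

lemma eps_chain_mono:
  assumes "eps_chain \<Omega> \<epsilon> x y xs" "\<epsilon> \<le> \<sigma>"
  shows "eps_chain \<Omega> \<sigma> x y xs"
  using assms by (force simp: eps_chain_def)

text \<open>Induction along the list, the start point moving one entry at a time. This turns a bound
  on single steps into confinement of whole chains.\<close>

lemma eps_chain_closed_under_steps:
  assumes "eps_chain \<Omega> \<epsilon> x y xs" "x \<in> A"
    and step: "\<And>a b. a \<in> A \<Longrightarrow> b \<in> \<Omega> \<Longrightarrow> dist a b < \<epsilon> \<Longrightarrow> b \<in> A"
  shows "y \<in> A"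
  using assms(1,2)
proof (induction xs arbitrary: x)
  case Nil
  then show ?case by (simp add: eps_chain_iff_successively)
next
  case (Cons a xs)
  show ?case
  proof (cases xs)
    case Nil
    then show ?thesis using Cons.prems by (auto simp: eps_chain_iff_successively)
  next
    case (Cons b ys)
    then have "eps_chain \<Omega> \<epsilon> b y xs" "b \<in> A"
      using Cons.prems step by (auto simp: eps_chain_iff_successively)
    then show ?thesis by (rule Cons.IH)
  qed
qed

lemma eps_rel_step:
  assumes "x \<in> \<Omega>" "y \<in> \<Omega>" "dist x y < \<epsilon>"
  shows "(x, y) \<in> eps_rel \<Omega> \<epsilon>"
proof -
  have "eps_chain \<Omega> \<epsilon> x y [x, y]"
    using assms by (simp add: eps_chain_iff_successively)
  then show ?thesis by (auto simp: eps_rel_def)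
qed

lemma eps_rel_subset: "eps_rel \<Omega> \<epsilon> \<subseteq> \<Omega> \<times> \<Omega>"
  by (auto simp: eps_rel_def eps_chain_iff_successively)

lemma equiv_eps_rel:
  assumes "\<epsilon> > 0"
  shows "equiv \<Omega> (eps_rel \<Omega> \<epsilon>)"
proof (rule equivI)
  show "eps_rel \<Omega> \<epsilon> \<subseteq> \<Omega> \<times> \<Omega>" by (rule eps_rel_subset)
  \<comment> \<open>The chain \<open>[x, x]\<close> has one step, of length 0 < \<epsilon>.\<close>
  show "refl_on \<Omega> (eps_rel \<Omega> \<epsilon>)"
    using assms by (simp add: refl_on_def eps_rel_step)
  show "sym (eps_rel \<Omega> \<epsilon>)"
    by (auto simp: eps_rel_def sym_def dest: eps_chain_rev)
  show "trans (eps_rel \<Omega> \<epsilon>)"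
    using assms eps_chain_append by (fastforce simp: eps_rel_def trans_def)
qed

lemma partition_on_eps_components:
  assumes "\<epsilon> > 0"
  shows "partition_on \<Omega> (eps_components \<Omega> \<epsilon>)"
  unfolding eps_components_def by (intro partition_on_quotient equiv_eps_rel assms)

lemma openin_eps_component:
  assumes "\<epsilon> > 0" "E \<in> eps_components \<Omega> \<epsilon>"
  shows "openin (top_of_set \<Omega>) E"
proof -
  note eq = equiv_eps_rel[OF assms(1), of \<Omega>]
  have "E \<subseteq> \<Omega>"
    using partition_on_eps_components[OF assms(1)] assms(2) by (auto simp: partition_on_def)
  moreover have "y \<in> E" if "x \<in> E" "y \<in> \<Omega>" "dist y x < \<epsilon>" for x y
  proof -
    have "(x, y) \<in> eps_rel \<Omega> \<epsilon>"
      using that \<open>E \<subseteq> \<Omega>\<close> by (auto intro: eps_rel_step simp: dist_commute)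
    then show ?thesis
      using in_quotient_imp_closed[OF eq] assms(2) that(1) by (auto simp: eps_components_def)
  qed
  ultimately show ?thesis
    unfolding openin_euclidean_subtopology_iff using assms(1) by blast
qed

text \<open>Closedness holds because the complement is the union of the other components, all of
  them open.\<close>

lemma clopen_in_eps_component:
  assumes "\<epsilon> > 0" "E \<in> eps_components \<Omega> \<epsilon>"
  shows "clopen_in \<Omega> E"
proof -
  have P: "partition_on \<Omega> (eps_components \<Omega> \<epsilon>)"
    by (rule partition_on_eps_components[OF assms(1)])
  have "E \<subseteq> \<Omega>" using P assms(2) by (auto simp: partition_on_def)
  have "\<Omega> - E = \<Union> (eps_components \<Omega> \<epsilon> - {E})"
    using P assms(2) by (auto simp: partition_on_def disjoint_def)
  then have "openin (top_of_set \<Omega>) (\<Omega> - E)"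
    using openin_eps_component[OF assms(1), of _ \<Omega>] by (auto intro!: openin_Union)
  then show ?thesis
    using \<open>E \<subseteq> \<Omega>\<close> openin_eps_component[OF assms] by (auto simp: clopen_in_def closedin_def)
qed

lemma finite_eps_components:
  assumes "compact \<Omega>" "\<epsilon> > 0"
  shows "finite (eps_components \<Omega> \<epsilon>)"
proof -
  let ?C = "eps_components \<Omega> \<epsilon>"
  have P: "partition_on \<Omega> ?C"
    by (rule partition_on_eps_components[OF assms(2)])
  have "\<And>E. E \<in> ?C \<Longrightarrow> openin (top_of_set \<Omega>) E"
    by (rule openin_eps_component[OF assms(2)])
  moreover have "\<Omega> \<subseteq> \<Union> ?C"
    using P by (simp add: partition_on_def)
  ultimately obtain D where D: "D \<subseteq> ?C" "finite D" "\<Omega> \<subseteq> \<Union> D"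
    using assms(1) unfolding compact_eq_openin_cover by meson
  \<comment> \<open>A subcover of a partition omits nothing: a point of \<open>E\<close> lies in
    some \<open>F\<close> in \<open>D\<close>, and disjointness forces \<open>F = E\<close>.\<close>
  have "?C \<subseteq> D"
  proof
    fix E assume E: "E \<in> ?C"
    moreover have "E \<noteq> {}" using P E by (auto simp: partition_on_def)
    ultimately obtain x where x: "x \<in> E" "x \<in> \<Omega>"
      using P by (auto simp: partition_on_def)
    then obtain F where "F \<in> D" "x \<in> F" using D by auto
    then show "E \<in> D"
      using P E x D(1) by (fastforce simp: partition_on_def disjoint_def)
  qed
  then show ?thesis using D(2) by (rule finite_subset)
qed

text \<open>An \<epsilon>-chain is also a \<sigma>-chain, so each \<epsilon>-class lies in the
  \<sigma>-class of the same representative.\<close>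

lemma refines_eps_components:
  assumes "0 < \<epsilon>" "\<epsilon> \<le> \<sigma>"
  shows "refines \<Omega> (eps_components \<Omega> \<epsilon>) (eps_components \<Omega> \<sigma>)"
proof -
  have "eps_rel \<Omega> \<epsilon> \<subseteq> eps_rel \<Omega> \<sigma>"
    using assms(2) eps_chain_mono by (fastforce simp: eps_rel_def)
  then have "\<exists>F \<in> eps_components \<Omega> \<sigma>. E \<subseteq> F" if "E \<in> eps_components \<Omega> \<epsilon>" for E
    using that by (fastforce simp: eps_components_def quotient_def)
  then show ?thesis
    using assms by (auto simp: refines_def intro: partition_on_eps_components)
qed

text \<open>Compactness of \<open>A\<close> supplies the positive distance to the rest of \<Omega>.
  The eventual form allows finitely many sets \<open>A\<close> to be treated at a common small
  \<epsilon>.\<close>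

lemma eventually_eps_rel_Image_subset:
  assumes "compact A" "openin (top_of_set \<Omega>) A"
  shows "\<forall>\<^sub>F \<epsilon> in at_right 0. eps_rel \<Omega> \<epsilon> `` A \<subseteq> A"
proof -
  obtain U where U: "open U" "A = \<Omega> \<inter> U"
    using assms(2) by (auto simp: openin_open)
  \<comment> \<open>A Lebesgue number of the one-set cover \<open>{U}\<close>: a radius that works
    at all points of \<open>A\<close>.\<close>
  obtain e where e: "e > 0" "\<And>x. x \<in> A \<Longrightarrow> ball x e \<subseteq> U"
    using Heine_Borel_lemma[OF assms(1), of "{U}"] U by auto
  have "eps_rel \<Omega> \<epsilon> `` A \<subseteq> A" if "\<epsilon> < e" for \<epsilon>
  proof
    fix y assume "y \<in> eps_rel \<Omega> \<epsilon> `` A"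
    then obtain x xs where x: "x \<in> A" "eps_chain \<Omega> \<epsilon> x y xs"
      by (auto simp: eps_rel_def)
    have "b \<in> A" if "a \<in> A" "b \<in> \<Omega>" "dist a b < \<epsilon>" for a b
      using that e(2)[of a] \<open>\<epsilon> < e\<close> U(2) by (auto simp: subset_iff)
    then show "y \<in> A"
      using eps_chain_closed_under_steps[OF x(2) x(1)] by blast
  qed
  then show ?thesis
    using e(1) by (auto simp: eventually_at_right_field)
qed

text \<open>The component \<open>{x}\<close> is disjoint from the closed set
  \<open>\<Omega> - ball x \<delta>\<close>, and in a compact Hausdorff space a component can be
  separated from such a set by a clopen partition.\<close>

lemma totally_disconnected_clopen_nhd:
  assumes "compact \<Omega>" "totally_disconnected \<Omega>" "x \<in> \<Omega>" "\<delta> > 0"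
  obtains A where "x \<in> A" "A \<subseteq> ball x \<delta>" "compact A" "openin (top_of_set \<Omega>) A"
proof -
  let ?X = "top_of_set \<Omega>"
  have "connected_component_set \<Omega> x \<in> components \<Omega>"
    using assms(3) by (auto simp: components_def)
  then have "connected_component_set \<Omega> x = {x}"
    using assms(2,3) connected_component_refl unfolding totally_disconnected_def
    by (metis mem_Collect_eq singletonD)
  \<comment> \<open>Passes to components of the abstract topology \<open>?X\<close>, in which the
    separation theorem is stated.\<close>
  then have "connected_component_of_set ?X x = {x}"
    by (auto simp: set_eq_iff connected_component_of_def connected_component_def
        connectedin_subtopology)
  then have "{x} \<in> connected_components_of ?X"
    using assms(3) by (auto simp: connected_components_of_def image_iff)
  moreover have "closedin ?X (\<Omega> - ball x \<delta>)"
    by (simp add: Diff_eq closedin_closed_Int closed_Compl)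
  moreover have "compact_space ?X" "Hausdorff_space ?X"
    using assms(1) by (auto simp: compact_space_subtopology Hausdorff_space_subtopology)
  ultimately have "separated_between ?X {x} (\<Omega> - ball x \<delta>)"
    using assms(3,4)
    by (intro separated_between_compact_connected_component)
      (auto simp: compact_imp_locally_compact_space disjnt_def)
  then obtain A B where AB: "openin ?X A" "openin ?X B" "A \<union> B = \<Omega>" "disjnt A B"
      "x \<in> A" "\<Omega> - ball x \<delta> \<subseteq> B"
    by (auto simp: separated_between_def)
  \<comment> \<open>As the complement of the open set \<open>B\<close>, the set \<open>A\<close> is
    also closed in \<Omega>, hence compact.\<close>
  have "A = \<Omega> - B" using AB by (auto simp: disjnt_def)
  then have "closedin ?X A" using AB(2) by (auto simp: openin_closedin_eq)
  then have "compact A" using assms(1) by (rule closedin_compact[rotated])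
  moreover have "A \<subseteq> ball x \<delta>" using AB by (auto simp: disjnt_def)
  ultimately show ?thesis using AB that by blast
qed

lemma eventually_diameter_eps_component_le:
  fixes \<Omega> :: "'a::metric_space set"
  assumes "compact \<Omega>" "totally_disconnected \<Omega>" "\<delta> > 0"
  shows "\<forall>\<^sub>F \<epsilon> in at_right 0. \<forall>E \<in> eps_components \<Omega> \<epsilon>. diameter E \<le> \<delta>"
proof -
  \<comment> \<open>Radius \<delta>/2 is chosen because two points of such a ball are at distance at
    most \<delta>.\<close>
  have "\<exists>A. x \<in> A \<and> A \<subseteq> ball x (\<delta>/2) \<and> compact A \<and> openin (top_of_set \<Omega>) A" if "x \<in> \<Omega>" for x
    using totally_disconnected_clopen_nhd[OF assms(1,2) that, of "\<delta>/2"] assms(3) by (metis half_gt_zero)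
  then obtain A where A: "\<And>x. x \<in> \<Omega> \<Longrightarrow> x \<in> A x \<and> A x \<subseteq> ball x (\<delta>/2) \<and> compact (A x)
      \<and> openin (top_of_set \<Omega>) (A x)"
    by metis
  then have "\<And>G. G \<in> A ` \<Omega> \<Longrightarrow> openin (top_of_set \<Omega>) G" "\<Omega> \<subseteq> \<Union> (A ` \<Omega>)" by auto
  then obtain D where "D \<subseteq> A ` \<Omega>" "finite D" "\<Omega> \<subseteq> \<Union> D"
    using assms(1) unfolding compact_eq_openin_cover by meson
  then obtain I where I: "finite I" "I \<subseteq> \<Omega>" "\<Omega> \<subseteq> \<Union> (A ` I)"
    by (metis finite_subset_image)
  have "\<forall>\<^sub>F \<epsilon> in at_right 0. \<forall>i \<in> I. eps_rel \<Omega> \<epsilon> `` A i \<subseteq> A i"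
    using I A by (intro eventually_ball_finite) (auto intro!: eventually_eps_rel_Image_subset)
  then show ?thesis
  proof eventually_elim
    case (elim \<epsilon>)
    show ?case
    proof
      fix E assume "E \<in> eps_components \<Omega> \<epsilon>"
      then obtain x where x: "x \<in> \<Omega>" "E = eps_rel \<Omega> \<epsilon> `` {x}"
        by (auto simp: eps_components_def elim: quotientE)
      then obtain i where i: "i \<in> I" "x \<in> A i" using I by auto
      \<comment> \<open>\<open>E\<close> is the class of \<open>x\<close>, and \<open>A i\<close>
        contains \<open>x\<close> and is closed under the relation, so \<open>E\<close> lies in
        \<open>A i\<close>.\<close>
      then have "E \<subseteq> ball i (\<delta>/2)"
        using elim x A[of i] I by blast
      then have "diameter E \<le> diameter (ball i (\<delta>/2))"
        by (simp add: diameter_subset)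
      also have "\<dots> \<le> \<delta>"
      proof -
        have "dist y z \<le> \<delta>" if "y \<in> ball i (\<delta>/2)" "z \<in> ball i (\<delta>/2)" for y z
          using that dist_triangle2[of y z i] by (simp add: dist_commute)
        then show ?thesis
          using assms(3) by (auto simp: diameter_def intro!: cSUP_least)
      qed
      finally show "diameter E \<le> \<delta>" .
    qed
  qed
qed

theorem proposition3p1:
  fixes \<Omega> :: "'a::metric_space set"
  assumes "\<Omega> \<noteq> {}" and "compact \<Omega>" and "totally_disconnected \<Omega>"
  shows "(\<forall>\<epsilon>>0. finite (eps_components \<Omega> \<epsilon>) \<and> partition_on \<Omega> (eps_components \<Omega> \<epsilon>) \<and>
            (\<forall>E \<in> eps_components \<Omega> \<epsilon>. clopen_in \<Omega> E)) \<and>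
         (\<forall>\<epsilon> \<sigma>. 0 < \<epsilon> \<and> \<epsilon> < \<sigma> \<longrightarrow> refines \<Omega> (eps_components \<Omega> \<epsilon>) (eps_components \<Omega> \<sigma>)) \<and>
         ((\<lambda>\<epsilon>. Max (diameter ` eps_components \<Omega> \<epsilon>)) \<longlongrightarrow> 0) (at_right 0)"
proof (intro conjI allI impI)
  show "((\<lambda>\<epsilon>. Max (diameter ` eps_components \<Omega> \<epsilon>)) \<longlongrightarrow> 0) (at_right 0)"
  proof (rule tendstoI)
    fix e :: real assume "e > 0"
    \<comment> \<open>Halving \<open>e\<close> turns the weak bound on diameters into the strict one
      that the limit requires.\<close>
    then have "\<forall>\<^sub>F \<epsilon> in at_right 0. \<forall>E \<in> eps_components \<Omega> \<epsilon>. diameter E \<le> e / 2"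
      by (intro eventually_diameter_eps_component_le assms) auto
    moreover have "\<forall>\<^sub>F \<epsilon> in at_right (0::real). \<epsilon> > 0"
      by (rule eventually_at_right_less)
    ultimately show "\<forall>\<^sub>F \<epsilon> in at_right 0. dist (Max (diameter ` eps_components \<Omega> \<epsilon>)) 0 < e"
    proof eventually_elim
      case (elim \<epsilon>)
      let ?C = "eps_components \<Omega> \<epsilon>"
      have P: "partition_on \<Omega> ?C" by (rule partition_on_eps_components[OF elim(2)])
      have fin: "finite ?C" by (rule finite_eps_components[OF assms(2) elim(2)])
      \<comment> \<open>\<open>Max\<close> is meaningful only on a finite nonempty set; nonemptiness
        comes from that of \<Omega>. The maximum is then attained at some \<open>E\<close>, to which
        the uniform bound applies.\<close>
      have ne: "?C \<noteq> {}" using P assms(1) by (auto simp: partition_on_def)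
      have "Max (diameter ` ?C) \<in> diameter ` ?C"
        using fin ne by (intro Max_in) auto
      then obtain E where E: "E \<in> ?C" "Max (diameter ` ?C) = diameter E" by auto
      \<comment> \<open>The distance to 0 is an absolute value, so a lower bound is needed too;
        \<open>diameter_ge_0\<close> gives it for the bounded set \<open>E\<close>.\<close>
      have "E \<subseteq> \<Omega>" using P E(1) by (auto simp: partition_on_def)
      then have "0 \<le> diameter E"
        using assms(2) by (meson bounded_subset compact_imp_bounded diameter_ge_0)
      moreover have "diameter E \<le> e / 2" using elim(1) E(1) by blast
      ultimately show ?case using E(2) \<open>e > 0\<close> by simp
    qed
  qed
qed (use assms in \<open>auto intro: finite_eps_components partition_on_eps_components
       clopen_in_eps_component refines_eps_components\<close>)

end
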